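(* Let $f:[0,\infty)\to\mathbb{R}$ be a function that is differentiable on $(0,\infty)$, let $0<u<v$, and suppose $f'\in L[u,v]$. Let $q>1$ and let $p$ satisfy $1/p+1/q=1$. If $|f'|^q$ is concave on $[u,v]$, then for each $x\in[u,v]$, $$\left|\frac{(v-x)(vf(v)-uf(x))+(x-u)(vf(x)-uf(u))}{(v-u)^2}-\frac{1}{v-u}\int_u^v f(\mu)\,d\mu\right|$$ $$\le \frac{L_p(u,v)}{(v-u)^2}\left[(v-x)^2\left|f'\left(\frac{x+v}{2}\right)\right|+(x-u)^2\left|f'\left(\frac{x+u}{2}\right)\right|\right].$$
   Context: $L[u,v]$ denotes the space of Lebesgue integrable functions on $[u,v]$. The generalized logarithmic mean is $L_p(u,v)=\left(\frac{v^{p+1}-u^{p+1}}{(p+1)(v-u)}\right)^{1/p}$ for $u\neq v$, $u,v>0$, $p\in\mathbb{R}\setminus\{-1,0\}$. *)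

theory Defs
  imports "HOL-Analysis.Analysis"
begin

(* Meaningful for u, v > 0, u \<noteq> v and p \<notin> {-1, 0}; the quotient is then positive, so that powr
   is the ordinary real power.  Outside that range the value is a junk value of totalised
   division and powr. *)
definition gen_log_mean :: "real \<Rightarrow> real \<Rightarrow> real \<Rightarrow> real" where
  "gen_log_mean p u v =
     ((v powr (p + 1) - u powr (p + 1)) / ((p + 1) * (v - u))) powr (1 / p)"

end

theory Submission
  imports Defs
begin

text \<open>
  On an interval \<open>[a, b]\<close> let \<open>k\<close> be the affine function with \<open>k a = u\<close> and \<open>k b = v\<close>.  Integration
  by parts turns \<open>\<integral> k f'\<close> into \<open>v f b - u f a - (v - u) / (b - a) \<integral> f\<close>
  (\<open>has_integral_affine_times_deriv\<close>).  Weighting these identities for \<open>[x, v]\<close> and \<open>[u, x]\<close> by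
  \<open>v - x\<close> and \<open>x - u\<close> and adding them gives \<open>(v - u)\<^sup>2\<close> times the expression to be estimated, so
  it is enough to bound \<open>\<bar>\<integral> k f'\<bar>\<close> on each piece by \<open>(b - a) L M\<close>, where \<open>L\<close> is the generalized
  logarithmic mean \<open>L\<^sub>p(u, v)\<close> and \<open>M = \<bar>f' ((a + b) / 2)\<bar>\<close>.

  This is Hoelder's inequality with the exponents \<open>p\<close> and \<open>q\<close>: the average of \<open>k\<^sup>p\<close> over \<open>[a, b]\<close>
  is that of \<open>s\<^sup>p\<close> over \<open>[u, v]\<close>, which is \<open>L\<^sup>p\<close>, and by the Hermite--Hadamard inequality the average
  of the concave function \<open>\<bar>f'\<bar>\<^sup>q\<close> is at most its value \<open>M\<^sup>q\<close> at the midpoint.  The two inequalities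
  are merged at the pointwise level (\<open>affine_weighted_integral_bound\<close>): for \<open>M > 0\<close>, Young's
  inequality for \<open>k / L\<close> and \<open>\<bar>f'\<bar> / M\<close>, followed by replacing \<open>\<bar>f'\<bar>\<^sup>q\<close> by a line supporting it from above at the
  midpoint, dominates \<open>k \<bar>f'\<bar> / (L M)\<close> by a function whose integral is explicitly
  \<open>(b - a) (1 / p + 1 / q) = b - a\<close>; for \<open>M = 0\<close>, concavity forces \<open>f' = 0\<close> on \<open>[a, b]\<close>.
\<close>

lemma concave_on_supporting_line:
  fixes g :: "real \<Rightarrow> real"
  assumes "concave_on I g" "m \<in> interior I"
  obtains c where "\<And>t. t \<in> I \<Longrightarrow> g t \<le> g m + c * (t - m)"
proof -
  define d where "d = Inf ((\<lambda>t. (- g m - - g t) / (m - t)) ` ({m<..} \<inter> I))"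
  have "- g t \<ge> - g m + d * (t - m)" if "t \<in> I" for t
    unfolding d_def using convex_le_Inf_differential[of I "\<lambda>t. - g t" m t] assms that
    by (simp add: concave_on_def)
  then have "g t \<le> g m + (- d) * (t - m)" if "t \<in> I" for t
    using that by fastforce
  then show thesis by (rule that)
qed

lemma gen_log_mean_powr:
  fixes p u v :: real
  assumes "0 < u" "u < v" "p > 0"
  shows "gen_log_mean p u v > 0"
    and "gen_log_mean p u v powr p = (v powr (p + 1) - u powr (p + 1)) / ((p + 1) * (v - u))"
proof -
  have "u powr (p + 1) < v powr (p + 1)"
    using assms by (intro powr_less_mono2) auto
  then have pos: "(v powr (p + 1) - u powr (p + 1)) / ((p + 1) * (v - u)) > 0"
    using assms by simp
  then show "gen_log_mean p u v > 0"
    unfolding gen_log_mean_def by (metis powr_gt_zero less_irrefl)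
  show "gen_log_mean p u v powr p = (v powr (p + 1) - u powr (p + 1)) / ((p + 1) * (v - u))"
    unfolding gen_log_mean_def powr_powr using powr_one[OF less_imp_le[OF pos]] assms(3) by simp
qed

lemma has_integral_affine_powr:
  fixes a b p u v :: real
  assumes "a < b" "0 < u" "u < v" "p > 0"
  shows "((\<lambda>t. (u + (v - u) / (b - a) * (t - a)) powr p) has_integral
           (b - a) * gen_log_mean p u v powr p) {a..b}"
proof -
  define c where "c = (v - u) / (b - a)"
  have c: "c > 0" and cb: "u + c * (b - a) = v"
    using assms by (simp_all add: c_def)
  define F where "F t = (u + c * (t - a)) powr (p + 1) / (c * (p + 1))" for t
  have "(F has_real_derivative (u + c * (t - a)) powr p) (at t)" if "t \<in> {a..b}" for t
  proof -
    have "u + c * (t - a) > 0" using that c assms by (simp add: add_pos_nonneg)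
    moreover have "((\<lambda>t. u + c * (t - a)) has_real_derivative c) (at t)"
      by (auto intro!: derivative_eq_intros)
    ultimately have "((\<lambda>t. (u + c * (t - a)) powr (p + 1)) has_real_derivative
        (p + 1) * (u + c * (t - a)) powr (p + 1 - of_nat 1) * c) (at t)"
      by (intro DERIV_fun_powr)
    then have "(F has_real_derivative
        (p + 1) * (u + c * (t - a)) powr (p + 1 - of_nat 1) * c / (c * (p + 1))) (at t)"
      unfolding F_def by (rule DERIV_cdivide)
    then show ?thesis using c assms by simp
  qed
  then have "((\<lambda>t. (u + c * (t - a)) powr p) has_integral (F b - F a)) {a..b}"
    using assms by (intro fundamental_theorem_of_calculus)
      (auto simp: has_real_derivative_iff_has_vector_derivative[symmetric]
            intro: has_field_derivative_at_within)
  moreover have "F b - F a = (b - a) * gen_log_mean p u v powr p"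
  proof -
    have "F b - F a = (v powr (p + 1) - u powr (p + 1)) / (c * (p + 1))"
      by (simp add: F_def cb diff_divide_distrib)
    also have "\<dots> = (b - a) * ((v powr (p + 1) - u powr (p + 1)) / ((p + 1) * (v - u)))"
      by (simp add: c_def mult.commute)
    finally show ?thesis
      using gen_log_mean_powr(2) assms by simp
  qed
  ultimately show ?thesis by (simp add: c_def)
qed

lemma has_integral_linear_about_midpoint:
  fixes a b c :: real
  assumes "a \<le> b"
  shows "((\<lambda>t. c * (t - (a + b) / 2)) has_integral 0) {a..b}"
proof -
  define F where "F t = c * (t - (a + b) / 2)\<^sup>2 / 2" for t
  have "((\<lambda>t. c * (t - (a + b) / 2)) has_integral (F b - F a)) {a..b}"
    using assms unfolding F_def
    by (intro fundamental_theorem_of_calculus)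
      (auto simp: has_real_derivative_iff_has_vector_derivative[symmetric]
            intro!: derivative_eq_intros)
  moreover have "F b - F a = 0"
    by (simp add: F_def power2_eq_square field_simps)
  ultimately show ?thesis by simp
qed

text \<open>
  Hoelder's inequality and the Hermite--Hadamard inequality in one step.  Scaling \<open>k\<close> by its
  \<open>p\<close>-mean \<open>L\<close> and \<open>\<bar>g\<bar>\<close> by its midpoint value \<open>M\<close> before applying Young's inequality makes the two
  terms of the majorant integrate to \<open>(b - a) / p\<close> and \<open>(b - a) / q\<close>; the slope of the supporting
  line drops out because the line is centred at the midpoint.
\<close>

lemma affine_weighted_integral_bound:
  fixes g :: "real \<Rightarrow> real" and a b p q u v I :: real
  assumes "a < b" "0 < u" "u < v" "p > 1" "q > 1" "1 / p + 1 / q = 1"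
    and concave: "concave_on {a..b} (\<lambda>t. \<bar>g t\<bar> powr q)"
    and I: "((\<lambda>t. (u + (v - u) / (b - a) * (t - a)) * g t) has_integral I) {a..b}"
  shows "\<bar>I\<bar> \<le> (b - a) * gen_log_mean p u v * \<bar>g ((a + b) / 2)\<bar>"
proof -
  define m where "m = (a + b) / 2"
  define k where "k t = u + (v - u) / (b - a) * (t - a)" for t
  define L where "L = gen_log_mean p u v"
  define M where "M = \<bar>g m\<bar>"
  have m: "a < m" "m < b" using assms by (auto simp: m_def)
  have L: "L > 0" using gen_log_mean_powr assms by (simp add: L_def)
  have k: "k t > 0" if "t \<in> {a..b}" for t
    using that assms by (simp add: k_def add_pos_nonneg)
  have "m \<in> interior {a..b}" using m by simp
  from concave_on_supporting_line[OF concave this] obtain c where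
    c: "\<And>t. t \<in> {a..b} \<Longrightarrow> \<bar>g t\<bar> powr q \<le> M powr q + c * (t - m)"
    unfolding M_def by blast
  show ?thesis
  proof (cases "M = 0")
    case True
    \<comment> \<open>The supporting line vanishes at \<open>m\<close> and is nonnegative on both sides of it, hence flat.\<close>
    have "c * (t - m) \<ge> 0" if "t \<in> {a..b}" for t
      using c[OF that] True by (smt (verit) powr_ge_zero powr_0)
    from this[of a] this[of b] have "c = 0"
      using m by (auto simp: zero_le_mult_iff)
    then have "\<bar>g t\<bar> powr q \<le> 0" if "t \<in> {a..b}" for t
      using c[OF that] True by simp
    then have "g t = 0" if "t \<in> {a..b}" for t
      using that by (smt (verit) powr_gt_zero)
    then have "((\<lambda>t. k t * g t) has_integral 0) {a..b}"
      by (intro has_integral_is_0) auto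
    with I have "I = 0"
      unfolding k_def by (rule has_integral_unique)
    then show ?thesis using True by (simp add: M_def m_def)
  next
    case False
    then have M: "M > 0" by (simp add: M_def)
    define h where "h t = L * M * (k t powr p / L powr p / p
      + (M powr q + c * (t - m)) / M powr q / q)" for t
    have le: "norm (k t * g t) \<le> h t" if t: "t \<in> {a..b}" for t
    proof -
      have "(k t / L) * (\<bar>g t\<bar> / M) \<le> (k t / L) powr p / p + (\<bar>g t\<bar> / M) powr q / q"
        using Youngs_inequality[of p q "k t / L" "\<bar>g t\<bar> / M"] assms k[OF t] L M by simp
      also have "\<dots> = k t powr p / L powr p / p + \<bar>g t\<bar> powr q / M powr q / q"
        using k[OF t] L M by (simp add: powr_divide)
      also have "\<dots> \<le> k t powr p / L powr p / p + (M powr q + c * (t - m)) / M powr q / q"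
        using c[OF t] assms by (intro add_left_mono divide_right_mono) auto
      finally have "L * M * ((k t / L) * (\<bar>g t\<bar> / M)) \<le> h t"
        unfolding h_def using L M by (intro mult_left_mono) auto
      then show ?thesis using k[OF t] L M by (simp add: abs_mult)
    qed
    have kp: "((\<lambda>t. k t powr p) has_integral (b - a) * L powr p) {a..b}"
      unfolding k_def L_def using assms by (intro has_integral_affine_powr) auto
    have line: "((\<lambda>t. M powr q + c * (t - m)) has_integral ((b - a) * M powr q + 0)) {a..b}"
      unfolding m_def using assms has_integral_const_real[of "M powr q" a b]
      by (intro has_integral_add has_integral_linear_about_midpoint) auto
    have "(h has_integral L * M * ((b - a) * L powr p / L powr p / p
        + ((b - a) * M powr q + 0) / M powr q / q)) {a..b}"
      unfolding h_def
      by (rule has_integral_mult_right[OF has_integral_add[OF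
            has_integral_divide[OF has_integral_divide[OF kp]]
            has_integral_divide[OF has_integral_divide[OF line]]]])
    also have "L * M * ((b - a) * L powr p / L powr p / p + ((b - a) * M powr q + 0) / M powr q / q)
        = L * M * (b - a) * (1 / p + 1 / q)"
      using L M by (simp add: distrib_left)
    finally have h: "(h has_integral L * M * (b - a)) {a..b}"
      using assms by simp
    have I': "((\<lambda>t. k t * g t) has_integral I) {a..b}"
      using I by (simp add: k_def)
    have "norm (integral {a..b} (\<lambda>t. k t * g t)) \<le> integral {a..b} h"
      using I' h le by (intro integral_norm_bound_integral) (auto simp: integrable_on_def)
    then have "\<bar>I\<bar> \<le> L * M * (b - a)"
      using I' h by (simp add: integral_unique)
    then show ?thesis by (simp add: L_def M_def m_def mult_ac)
  qed
qed

lemma has_integral_affine_times_deriv: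
  fixes f f' :: "real \<Rightarrow> real" and a b u v :: real
  assumes "a < b"
    and f: "\<And>t. t \<in> {a..b} \<Longrightarrow> (f has_real_derivative f' t) (at t within {a..b})"
  shows "((\<lambda>t. (u + (v - u) / (b - a) * (t - a)) * f' t) has_integral
           (v * f b - u * f a - (v - u) / (b - a) * integral {a..b} f)) {a..b}"
proof -
  define c where "c = (v - u) / (b - a)"
  have cb: "u + c * (b - a) = v" using assms by (simp add: c_def)
  have "continuous_on {a..b} f"
    using f by (meson DERIV_continuous_on)
  then have int: "((\<lambda>t. c * f t) has_integral (c * integral {a..b} f)) {a..b}"
    by (intro has_integral_mult_right integrable_integral integrable_continuous_real)
  have "((\<lambda>t. c * f t + (u + c * (t - a)) * f' t) has_integral
      ((u + c * (b - a)) * f b - (u + c * (a - a)) * f a)) {a..b}"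
    using assms(1) f
    by (intro fundamental_theorem_of_calculus[where f = "\<lambda>t. (u + c * (t - a)) * f t"])
      (auto simp: has_real_derivative_iff_has_vector_derivative[symmetric]
            intro!: derivative_eq_intros)
  from has_integral_diff[OF this int] show ?thesis
    by (simp add: cb) (simp add: c_def)
qed

text \<open>
  The estimate for one of the two pieces, multiplied by \<open>b - a\<close> so that it stays meaningful for
  the degenerate piece that occurs when \<open>x\<close> is an endpoint of \<open>[u, v]\<close>.
\<close>

lemma affine_trapezoid_bound:
  fixes f f' :: "real \<Rightarrow> real" and a b p q u v :: real
  assumes "a \<le> b" "0 < u" "u < v" "p > 1" "q > 1" "1 / p + 1 / q = 1"
    and f: "\<And>t. t \<in> {a..b} \<Longrightarrow> (f has_real_derivative f' t) (at t within {a..b})"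
    and concave: "concave_on {a..b} (\<lambda>t. \<bar>f' t\<bar> powr q)"
  shows "\<bar>(b - a) * (v * f b - u * f a) - (v - u) * integral {a..b} f\<bar>
           \<le> gen_log_mean p u v * ((b - a)\<^sup>2 * \<bar>f' ((a + b) / 2)\<bar>)"
proof (cases "a = b")
  case False
  with assms have ab: "a < b" by simp
  define I where "I = v * f b - u * f a - (v - u) / (b - a) * integral {a..b} f"
  have "\<bar>I\<bar> \<le> (b - a) * gen_log_mean p u v * \<bar>f' ((a + b) / 2)\<bar>"
    using affine_weighted_integral_bound[OF ab assms(2-6) concave]
      has_integral_affine_times_deriv[OF ab f] by (simp add: I_def)
  then have "(b - a) * \<bar>I\<bar> \<le> (b - a) * ((b - a) * gen_log_mean p u v * \<bar>f' ((a + b) / 2)\<bar>)"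
    using ab by (intro mult_left_mono) auto
  also have "(b - a) * \<bar>I\<bar> = \<bar>(b - a) * I\<bar>"
    using ab by (simp add: abs_mult)
  also have "(b - a) * I = (b - a) * (v * f b - u * f a) - (v - u) * integral {a..b} f"
    using ab by (simp add: I_def right_diff_distrib)
  finally show ?thesis by (simp add: power2_eq_square mult_ac)
qed simp

theorem theorem10:
  fixes f :: "real \<Rightarrow> real" and u v p q x :: real
  assumes "f differentiable_on {0<..}"
    and "0 < u" and "u < v"
    and "deriv f absolutely_integrable_on {u..v}"
    and "q > 1" and "1 / p + 1 / q = 1"
    and "concave_on {u..v} (\<lambda>t. \<bar>deriv f t\<bar> powr q)"
    and "x \<in> {u..v}"
  shows "\<bar>((v - x) * (v * f v - u * f x) + (x - u) * (v * f x - u * f u)) / (v - u)\<^sup>2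
           - 1 / (v - u) * (LINT \<mu>:{u..v}|lebesgue. f \<mu>)\<bar>
         \<le> gen_log_mean p u v / (v - u)\<^sup>2 *
             ((v - x)\<^sup>2 * \<bar>deriv f ((x + v) / 2)\<bar> + (x - u)\<^sup>2 * \<bar>deriv f ((x + u) / 2)\<bar>)"
proof -
  define L where "L = gen_log_mean p u v"
  have x: "u \<le> x" "x \<le> v" using assms(8) by auto
  have p: "p > 1"
  proof -
    have "1 / p = 1 - 1 / q" using assms(6) by simp
    moreover have "0 < 1 - 1 / q" "1 - 1 / q < 1" using assms(5) by auto
    ultimately have "0 < 1 / p" "1 / p < 1" by auto
    then show ?thesis by (simp add: divide_simps split: if_splits)
  qed
  have deriv: "(f has_real_derivative deriv f t) (at t)" if "t > 0" for t
  proof -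
    have "f differentiable at t"
      using assms(1) that by (simp add: differentiable_on_eq_differentiable_at)
    then show ?thesis
      by (metis real_differentiableE DERIV_imp_deriv)
  qed
  have concave: "concave_on S (\<lambda>t. \<bar>deriv f t\<bar> powr q)" if "S \<subseteq> {u..v}" "convex S" for S
    using assms(7) that unfolding concave_on_def by (metis convex_on_subset)
  have right: "\<bar>(v - x) * (v * f v - u * f x) - (v - u) * integral {x..v} f\<bar>
      \<le> L * ((v - x)\<^sup>2 * \<bar>deriv f ((x + v) / 2)\<bar>)"
    unfolding L_def using assms x p
    by (intro affine_trapezoid_bound[where q = q] concave)
      (auto intro!: has_field_derivative_at_within[OF deriv])
  have left: "\<bar>(x - u) * (v * f x - u * f u) - (v - u) * integral {u..x} f\<bar>
      \<le> L * ((x - u)\<^sup>2 * \<bar>deriv f ((u + x) / 2)\<bar>)"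
    unfolding L_def using assms x p
    by (intro affine_trapezoid_bound[where q = q] concave)
      (auto intro!: has_field_derivative_at_within[OF deriv])
  have cont: "continuous_on {u..v} f"
    using assms(2) by (intro continuous_at_imp_continuous_on) (auto intro!: DERIV_isCont[OF deriv])
  have "(LINT \<mu>:{u..v}|lebesgue. f \<mu>) = integral {u..v} f"
    by (rule set_lebesgue_integral_eq_integral(2)[OF absolutely_integrable_continuous_real[OF cont]])
  also have "\<dots> = integral {u..x} f + integral {x..v} f"
    using x cont
    by (intro Henstock_Kurzweil_Integration.integral_combine[symmetric] integrable_continuous_real)
  finally have split: "(LINT \<mu>:{u..v}|lebesgue. f \<mu>) = integral {u..x} f + integral {x..v} f" .
  define E where "E = ((v - x) * (v * f v - u * f x) + (x - u) * (v * f x - u * f u))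
    - (v - u) * (integral {u..x} f + integral {x..v} f)"
  have "E = ((v - x) * (v * f v - u * f x) - (v - u) * integral {x..v} f)
      + ((x - u) * (v * f x - u * f u) - (v - u) * integral {u..x} f)"
    unfolding E_def by (simp add: algebra_simps)
  then have "\<bar>E\<bar> \<le> L * ((v - x)\<^sup>2 * \<bar>deriv f ((x + v) / 2)\<bar>)
      + L * ((x - u)\<^sup>2 * \<bar>deriv f ((u + x) / 2)\<bar>)"
    using left right by linarith
  then have E: "\<bar>E\<bar> / (v - u)\<^sup>2 \<le> (L * ((v - x)\<^sup>2 * \<bar>deriv f ((x + v) / 2)\<bar>)
      + L * ((x - u)\<^sup>2 * \<bar>deriv f ((u + x) / 2)\<bar>)) / (v - u)\<^sup>2"
    by (intro divide_right_mono) auto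
  have "((v - x) * (v * f v - u * f x) + (x - u) * (v * f x - u * f u)) / (v - u)\<^sup>2
      - 1 / (v - u) * (LINT \<mu>:{u..v}|lebesgue. f \<mu>) = E / (v - u)\<^sup>2"
    using assms(3) by (simp add: E_def split diff_divide_distrib power2_eq_square)
  with E show ?thesis
    by (simp add: L_def distrib_left add_divide_distrib add.commute)
qed

end
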